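(* Let $F$ be a field of characteristic $0$, let $\mathfrak{g}$ be a Lie algebra over $F$, let $R$ be a Rota-Baxter operator of weight $1$ on $\mathfrak{g}$, and let $B$ be the (unique) Rota-Baxter operator on the Hopf algebra $U(\mathfrak{g})$ with $B|_{\mathfrak{g}}=R$. Let $(\mathfrak{g},[\,,],\cdot)$ be the post-Lie algebra with $x\cdot y=[R(x),y]$, and let $\cdot$ also denote the unique extension of this post-Lie product to a bilinear operation on $U(\mathfrak{g})$ satisfying, for all $x\in\mathfrak{g}$ and $f,g,h\in U(\mathfrak{g})$, $$1\cdot f=f,\qquad (xf)\cdot g=x\cdot(f\cdot g)-(x\cdot f)\cdot g,\qquad f\cdot(gh)=(f_{(1)}\cdot g)(f_{(2)}\cdot h).$$ Then for all $f,g\in U(\mathfrak{g})$, $$f\cdot g=B(f_{(1)})\,g\,S(B(f_{(2)})).$$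
   Context: A Rota-Baxter operator of weight $1$ on a Lie algebra $\mathfrak{g}$ is a linear map $R\colon\mathfrak{g}\to\mathfrak{g}$ with $[R(x),R(y)]=R([R(x),y]+[x,R(y)]+[x,y])$ for all $x,y\in\mathfrak{g}$. Sumless Sweedler notation $\Delta(x)=x_{(1)}\otimes x_{(2)}$ (and similarly for iterated comultiplications) is used. A linear map $B\colon H\to H$ of a coalgebra is a coalgebra map if $\Delta(B(x))=B(x_{(1)})\otimes B(x_{(2)})$ and $\epsilon(B(x))=\epsilon(x)$ for all $x$. If $H$ is a cocommutative Hopf algebra with antipode $S$, a Rota-Baxter operator on the Hopf algebra $H$ is a coalgebra map $B\colon H\to H$ such that $B(x)B(y)=B\big(x_{(1)}B(x_{(2)})\,y\,S(B(x_{(3)}))\big)$ for all $x,y\in H$. $U(\mathfrak{g})$ carries its usual cocommutative Hopf structure (elements of $\mathfrak{g}$ primitive) with antipode $S$. Every Rota-Baxter operator $R$ of weight $1$ on $\mathfrak{g}$ extends uniquely to a Rota-Baxter operator $B$ on the Hopf algebra $U(\mathfrak{g})$; it is determined by $B(1)=1$, $B|_{\mathfrak g}=R$ and $B(xh)=B(x)B(h)-B([B(x),h])$ for $x\in\mathfrak{g}$, $h\in U(\mathfrak{g})$, where $[a,b]=ab-ba$. A post-Lie algebra is a Lie algebra $(\mathfrak{g},[\,,])$ with a bilinear operation $\cdot$ satisfying $[x,y]\cdot z=(y\cdot x)\cdot z-y\cdot(x\cdot z)-(x\cdot y)\cdot z+x\cdot(y\cdot z)$ and $x\cdot[y,z]=[x\cdot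 y,z]+[y,x\cdot z]$ for all $x,y,z$. It is known that $x\cdot y=[R(x),y]$ defines a post-Lie algebra, and that for any post-Lie algebra the product $\cdot$ has a unique extension to $U(\mathfrak{g})$ satisfying the three displayed identities. *)

theory Defs
  imports Complex_Main "HOL-Library.Poly_Mapping"
begin

section \<open>Free vector spaces and tensors\<close>

definition free_scale :: "'k::field \<Rightarrow> ('a \<Rightarrow>\<^sub>0 'k) \<Rightarrow> ('a \<Rightarrow>\<^sub>0 'k)" where
  "free_scale c p = Poly_Mapping.map ((*) c) p"

lemma lookup_free_scale [simp]:
  "Poly_Mapping.lookup (free_scale c p) w = c * Poly_Mapping.lookup p w"
  unfolding free_scale_def by (transfer) (auto simp: when_def)

global_interpretation free: vector_space free_scale
  by unfold_locales (auto intro!: poly_mapping_eqI simp: lookup_add algebra_simps)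

definition free_extend :: "('k::field \<Rightarrow> 'v \<Rightarrow> 'v) \<Rightarrow> ('a \<Rightarrow> 'v) \<Rightarrow> ('a \<Rightarrow>\<^sub>0 'k) \<Rightarrow> 'v::ab_group_add" where
  "free_extend scale \<phi> p = (\<Sum>w\<in>Poly_Mapping.keys p. scale (Poly_Mapping.lookup p w) (\<phi> w))"

text \<open>
  A list \<open>[v\<^sub>1, \<dots>, v\<^sub>n]\<close> stands for the pure tensor \<open>v\<^sub>1 \<otimes> \<dots> \<otimes> v\<^sub>n\<close>.  The tensor algebra of
  \<open>V\<close> is the free vector space on all lists over \<open>V\<close> modulo the span of the relations below; these
  preserve length, so in each length \<open>n\<close> the quotient is the \<open>n\<close>-fold tensor power of \<open>V\<close>.
\<close>

definition multilinear_relations ::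
    "('k::field \<Rightarrow> 'v \<Rightarrow> 'v) \<Rightarrow> ('v::ab_group_add list \<Rightarrow>\<^sub>0 'k) set" where
  "multilinear_relations scale =
    {Poly_Mapping.single (u @ (x + y) # v) 1 - Poly_Mapping.single (u @ x # v) 1
       - Poly_Mapping.single (u @ y # v) 1 | u v x y. True} \<union>
    {Poly_Mapping.single (u @ scale c x # v) 1 - Poly_Mapping.single (u @ x # v) c | u v c x. True}"

text \<open>
  A list of pairs \<open>[(a\<^sub>1, b\<^sub>1), \<dots>, (a\<^sub>n, b\<^sub>n)]\<close> denotes the element \<open>\<Sum>i. a\<^sub>i \<otimes> b\<^sub>i\<close> of \<open>V \<otimes> V\<close>;
  likewise for triples.  Equality of the denoted tensors is \<open>tensor2_eq\<close> and \<open>tensor3_eq\<close>.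
\<close>

definition tensor_eq ::
    "('k::field \<Rightarrow> 'v \<Rightarrow> 'v) \<Rightarrow> 'v::ab_group_add list list \<Rightarrow> 'v list list \<Rightarrow> bool" where
  "tensor_eq scale s t \<longleftrightarrow>
    (\<Sum>w\<leftarrow>s. Poly_Mapping.single w 1) - (\<Sum>w\<leftarrow>t. Poly_Mapping.single w 1)
      \<in> free.span (multilinear_relations scale)"

definition tensor2_eq ::
    "('k::field \<Rightarrow> 'v \<Rightarrow> 'v) \<Rightarrow> ('v::ab_group_add \<times> 'v) list \<Rightarrow> ('v \<times> 'v) list \<Rightarrow> bool" where
  "tensor2_eq scale s t \<longleftrightarrow>
    tensor_eq scale (map (\<lambda>(a, b). [a, b]) s) (map (\<lambda>(a, b). [a, b]) t)"

definition tensor3_eq ::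
    "('k::field \<Rightarrow> 'v \<Rightarrow> 'v) \<Rightarrow> ('v::ab_group_add \<times> 'v \<times> 'v) list \<Rightarrow> ('v \<times> 'v \<times> 'v) list \<Rightarrow> bool" where
  "tensor3_eq scale s t \<longleftrightarrow>
    tensor_eq scale (map (\<lambda>(a, b, c). [a, b, c]) s) (map (\<lambda>(a, b, c). [a, b, c]) t)"

definition bilinear_map ::
    "('k::field \<Rightarrow> 'a \<Rightarrow> 'a) \<Rightarrow> ('k \<Rightarrow> 'b \<Rightarrow> 'b) \<Rightarrow> ('k \<Rightarrow> 'c \<Rightarrow> 'c) \<Rightarrow>
      ('a::ab_group_add \<Rightarrow> 'b::ab_group_add \<Rightarrow> 'c::ab_group_add) \<Rightarrow> bool" where
  "bilinear_map s1 s2 s3 \<beta> \<longleftrightarrow>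
    (\<forall>x. Vector_Spaces.linear s2 s3 (\<beta> x)) \<and> (\<forall>y. Vector_Spaces.linear s1 s3 (\<lambda>x. \<beta> x y))"


section \<open>Lie algebras, Rota-Baxter operators of weight 1, post-Lie algebras\<close>

locale lie_algebra = vector_space scale
  for scale :: "'k::field \<Rightarrow> 'g::ab_group_add \<Rightarrow> 'g" +
  fixes bracket :: "'g \<Rightarrow> 'g \<Rightarrow> 'g"
  assumes bracket_bilinear: "bilinear_map scale scale scale bracket"
    and bracket_self: "bracket x x = 0"
    and jacobi: "bracket x (bracket y z) + bracket y (bracket z x) + bracket z (bracket x y) = 0"

locale rota_baxter_lie_algebra = lie_algebra scale bracket
  for scale :: "'k::field \<Rightarrow> 'g::ab_group_add \<Rightarrow> 'g" and bracket +
  fixes R :: "'g \<Rightarrow> 'g"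
  assumes R_linear: "Vector_Spaces.linear scale scale R"
    and R_rota_baxter:
      "bracket (R x) (R y) = R (bracket (R x) y + bracket x (R y) + bracket x y)"

locale post_lie_algebra = lie_algebra scale bracket
  for scale :: "'k::field \<Rightarrow> 'g::ab_group_add \<Rightarrow> 'g" and bracket +
  fixes post :: "'g \<Rightarrow> 'g \<Rightarrow> 'g"
  assumes post_bilinear: "bilinear_map scale scale scale post"
    and post_bracket_left:
      "post (bracket x y) z = post (post y x) z - post y (post x z) - post (post x y) z + post x (post y z)"
    and post_bracket_right:
      "post x (bracket y z) = bracket (post x y) z + bracket y (post x z)"


section \<open>Cocommutative Hopf algebras\<close>

locale unital_algebra = vector_space scale
  for scale :: "'k::field \<Rightarrow> 'u::ring_1 \<Rightarrow> 'u" +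
  assumes scale_mult_left: "scale c (x * y) = scale c x * y"
    and scale_mult_right: "scale c (x * y) = x * scale c y"

text \<open>
  \<open>\<Delta> x\<close> is a chosen Sweedler representative of the comultiplication of \<open>x\<close>: all identities between
  tensors hold modulo \<open>tensor2_eq\<close> or \<open>tensor3_eq\<close>, and \<open>\<Sum>(a, b)\<leftarrow>\<Delta> x. \<beta> a b\<close> is independent of the
  representative for bilinear \<open>\<beta>\<close> (lemma \<open>sweedler_sum_cong\<close>).
\<close>

locale cocommutative_hopf_algebra = unital_algebra scale
  for scale :: "'k::field \<Rightarrow> 'u::ring_1 \<Rightarrow> 'u" +
  fixes \<Delta> :: "'u \<Rightarrow> ('u \<times> 'u) list" and \<epsilon> :: "'u \<Rightarrow> 'k" and S :: "'u \<Rightarrow> 'u"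
  assumes comult_add: "tensor2_eq scale (\<Delta> (x + y)) (\<Delta> x @ \<Delta> y)"
    and comult_scale: "tensor2_eq scale (\<Delta> (scale c x)) [(scale c a, b). (a, b) \<leftarrow> \<Delta> x]"
    and coassoc: "tensor3_eq scale
          [(a1, a2, b). (a, b) \<leftarrow> \<Delta> x, (a1, a2) \<leftarrow> \<Delta> a]
          [(a, b1, b2). (a, b) \<leftarrow> \<Delta> x, (b1, b2) \<leftarrow> \<Delta> b]"
    and cocommutative: "tensor2_eq scale (\<Delta> x) [(b, a). (a, b) \<leftarrow> \<Delta> x]"
    and counit_linear: "Vector_Spaces.linear scale (*) \<epsilon>"
    and counit_left: "(\<Sum>(a, b)\<leftarrow>\<Delta> x. scale (\<epsilon> a) b) = x"
    and counit_right: "(\<Sum>(a, b)\<leftarrow>\<Delta> x. scale (\<epsilon> b) a) = x"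
    and comult_one: "tensor2_eq scale (\<Delta> 1) [(1, 1)]"
    and comult_mult: "tensor2_eq scale (\<Delta> (x * y)) [(a * c, b * d). (a, b) \<leftarrow> \<Delta> x, (c, d) \<leftarrow> \<Delta> y]"
    and counit_one: "\<epsilon> 1 = 1"
    and counit_mult: "\<epsilon> (x * y) = \<epsilon> x * \<epsilon> y"
    and antipode_linear: "Vector_Spaces.linear scale scale S"
    and antipode_left: "(\<Sum>(a, b)\<leftarrow>\<Delta> x. S a * b) = scale (\<epsilon> x) 1"
    and antipode_right: "(\<Sum>(a, b)\<leftarrow>\<Delta> x. a * S b) = scale (\<epsilon> x) 1"

locale rota_baxter_hopf_algebra = cocommutative_hopf_algebra scale \<Delta> \<epsilon> S
  for scale :: "'k::field \<Rightarrow> 'u::ring_1 \<Rightarrow> 'u" and \<Delta> \<epsilon> S +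
  fixes B :: "'u \<Rightarrow> 'u"
  assumes B_linear: "Vector_Spaces.linear scale scale B"
    and B_comult: "tensor2_eq scale (\<Delta> (B x)) [(B a, B b). (a, b) \<leftarrow> \<Delta> x]"
    and B_counit: "\<epsilon> (B x) = \<epsilon> x"
    and B_rota_baxter:
      "B x * B y = B (\<Sum>(a, b, c)\<leftarrow>[(a1, a2, b). (a, b) \<leftarrow> \<Delta> x, (a1, a2) \<leftarrow> \<Delta> a]. a * B b * y * S (B c))"


section \<open>The universal enveloping algebra\<close>

text \<open>
  The span of these relations is the kernel of the projection from the free vector space on all lists
  over \<open>\<gg>\<close> (under concatenation, the free unital algebra on the set \<open>\<gg>\<close>) onto
  \<open>U(\<gg>) = T(\<gg>) / (x \<otimes> y - y \<otimes> x - [x, y])\<close>.  The prefixes \<open>u\<close> and suffixes \<open>v\<close> make the span a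
  two-sided ideal.
\<close>

definition enveloping_relations ::
    "('k::field \<Rightarrow> 'g \<Rightarrow> 'g) \<Rightarrow> ('g \<Rightarrow> 'g \<Rightarrow> 'g) \<Rightarrow> ('g::ab_group_add list \<Rightarrow>\<^sub>0 'k) set" where
  "enveloping_relations scale bracket = multilinear_relations scale \<union>
    {Poly_Mapping.single (u @ [x, y] @ v) 1 - Poly_Mapping.single (u @ [y, x] @ v) 1
       - Poly_Mapping.single (u @ [bracket x y] @ v) 1 | u v x y. True}"

text \<open>
  \<open>(U, \<iota>)\<close> is a universal enveloping algebra if the algebra homomorphism from the free algebra on \<open>\<gg>\<close>
  to \<open>U\<close> extending \<open>\<iota>\<close> is onto with the ideal above as kernel, i.e. identifies the quotient with
  \<open>U\<close>.  The universal property is lemma \<open>universal_property\<close>.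
\<close>

locale enveloping_algebra = lie_algebra scale bracket + U: unital_algebra scaleU
  for scale :: "'k::field \<Rightarrow> 'g::ab_group_add \<Rightarrow> 'g" and bracket
    and scaleU :: "'k \<Rightarrow> 'u::ring_1 \<Rightarrow> 'u" +
  fixes \<iota> :: "'g \<Rightarrow> 'u"
  assumes enveloping_surj: "surj (free_extend scaleU (\<lambda>w. prod_list (map \<iota> w)))"
    and enveloping_kernel:
      "{p. free_extend scaleU (\<lambda>w. prod_list (map \<iota> w)) p = 0}
        = free.span (enveloping_relations scale bracket)"

locale enveloping_hopf_algebra =
  enveloping_algebra scale bracket scaleU \<iota> + cocommutative_hopf_algebra scaleU \<Delta> \<epsilon> S
  for scale :: "'k::field \<Rightarrow> 'g::ab_group_add \<Rightarrow> 'g" and bracket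
    and scaleU :: "'k \<Rightarrow> 'u::ring_1 \<Rightarrow> 'u" and \<iota> \<Delta> \<epsilon> S +
  assumes primitive: "tensor2_eq scaleU (\<Delta> (\<iota> x)) [(\<iota> x, 1), (1, \<iota> x)]"

locale post_lie_extension =
  enveloping_hopf_algebra scale bracket scaleU \<iota> \<Delta> \<epsilon> S + post_lie_algebra scale bracket post
  for scale :: "'k::field \<Rightarrow> 'g::ab_group_add \<Rightarrow> 'g" and bracket
    and scaleU :: "'k \<Rightarrow> 'u::ring_1 \<Rightarrow> 'u" and \<iota> \<Delta> \<epsilon> S and post +
  fixes ext :: "'u \<Rightarrow> 'u \<Rightarrow> 'u"
  assumes ext_bilinear: "bilinear_map scaleU scaleU scaleU ext"
    and ext_extends: "ext (\<iota> x) (\<iota> y) = \<iota> (post x y)"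
    and ext_one: "ext 1 f = f"
    and ext_mult_left: "ext (\<iota> x * f) g = ext (\<iota> x) (ext f g) - ext (ext (\<iota> x) f) g"
    and ext_mult_right: "ext f (g * h) = (\<Sum>(a, b)\<leftarrow>\<Delta> f. ext a g * ext b h)"


section \<open>Basic facts\<close>

lemma (in rota_baxter_lie_algebra) post_lie: "post_lie_algebra scale bracket (\<lambda>x y. bracket (R x) y)"
proof -
  have bl: "Vector_Spaces.linear scale scale (bracket x)"
      "Vector_Spaces.linear scale scale (\<lambda>x. bracket x y)" for x y
    using bracket_bilinear by (auto simp: bilinear_map_def)
  note hom = bl[THEN Vector_Spaces.linear.axioms(3)] R_linear[THEN Vector_Spaces.linear.axioms(3)]
  note br = hom(1)[THEN module_hom.add] hom(2)[THEN module_hom.add]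
    hom(1)[THEN module_hom.diff] hom(2)[THEN module_hom.diff]
    hom(1)[THEN module_hom.neg] hom(2)[THEN module_hom.neg]
  note R = hom(3)[THEN module_hom.add] hom(3)[THEN module_hom.neg]
  have anti: "bracket y x = - bracket x y" for x y
  proof -
    have "bracket (x + y) (x + y) = bracket x x + bracket x y + (bracket y x + bracket y y)"
      by (simp only: br add.assoc add.left_commute)
    then have "bracket x y + bracket y x = 0" by (simp add: bracket_self)
    then show ?thesis by (metis add.commute eq_neg_iff_add_eq_0)
  qed
  have jac: "bracket x (bracket y z) = bracket (bracket x y) z + bracket y (bracket x z)" for x y z
  proof -
    have "bracket y (bracket z x) = - bracket y (bracket x z)"
      by (subst anti[of z x]) (simp only: br)
    with jacobi[of x y z] show ?thesis
      by (simp only: anti[of z "bracket x y"]) (simp add: algebra_simps eq_neg_iff_add_eq_0)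
  qed
  show ?thesis
  proof
    show "bilinear_map scale scale scale (\<lambda>x y. bracket (R x) y)"
      using bl R_linear Vector_Spaces.linear_compose[OF R_linear bl(2)]
      by (auto simp: bilinear_map_def o_def)
    show "bracket (R x) (bracket y z) = bracket (bracket (R x) y) z + bracket y (bracket (R x) z)" for x y z
      by (rule jac)
    show "bracket (R (bracket x y)) z = bracket (R (bracket (R y) x)) z
        - bracket (R y) (bracket (R x) z) - bracket (R (bracket (R x) y)) z
        + bracket (R x) (bracket (R y) z)" for x y z
    proof -
      have "bracket (R x) (bracket (R y) z) - bracket (R y) (bracket (R x) z) = bracket (bracket (R x) (R y)) z"
        by (simp add: jac[of "R x"])
      also have "\<dots> = bracket (R (bracket (R x) y)) z - bracket (R (bracket (R y) x)) z + bracket (R (bracket x y)) z"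
        unfolding R_rota_baxter anti[of "R y" x] by (simp add: R br)
      finally show ?thesis by (simp add: algebra_simps)
    qed
  qed
qed

lemma (in vector_space) free_extend_superset:
  assumes "finite K" "Poly_Mapping.keys p \<subseteq> K"
  shows "free_extend scale \<phi> p = (\<Sum>w\<in>K. scale (Poly_Mapping.lookup p w) (\<phi> w))"
  unfolding free_extend_def using assms
  by (intro sum.mono_neutral_left) (auto simp: in_keys_iff)

lemma (in vector_space) free_extend_linear: "Vector_Spaces.linear free_scale scale (free_extend scale \<phi>)"
proof -
  have add: "free_extend scale \<phi> (p + q) = free_extend scale \<phi> p + free_extend scale \<phi> q" for p q
  proof -
    let ?K = "Poly_Mapping.keys p \<union> Poly_Mapping.keys q"
    have "Poly_Mapping.keys (p + q) \<subseteq> ?K" by (rule Poly_Mapping.keys_add)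
    then show ?thesis
      by (simp add: free_extend_superset[of ?K] lookup_add scale_left_distrib sum.distrib)
  qed
  have scl: "free_extend scale \<phi> (free_scale c p) = scale c (free_extend scale \<phi> p)" for c p
  proof -
    have "Poly_Mapping.keys (free_scale c p) \<subseteq> Poly_Mapping.keys p" by (auto simp: in_keys_iff)
    then show ?thesis
      by (simp add: free_extend_superset[of "Poly_Mapping.keys p"] scale_sum_right)
  qed
  show ?thesis
    by (intro Vector_Spaces.linear.intro module_hom.intro module_hom_axioms.intro add scl)
      unfold_locales
qed

lemma (in vector_space) free_extend_single [simp]:
  "free_extend scale \<phi> (Poly_Mapping.single w c) = scale c (\<phi> w)"
  by (cases "c = 0") (simp_all add: free_extend_def)

lemma sweedler_sum_cong:
  assumes bil: "bilinear_map scale scale scale' \<beta>" and eq: "tensor2_eq scale s t"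
  shows "(\<Sum>(a, b)\<leftarrow>s. \<beta> a b) = (\<Sum>(a, b)\<leftarrow>t. \<beta> a b)"
proof -
  have lin: "Vector_Spaces.linear scale scale' (\<beta> x)" "Vector_Spaces.linear scale scale' (\<lambda>x. \<beta> x y)" for x y
    using bil by (auto simp: bilinear_map_def)
  interpret V': vector_space scale' using lin(1) by (rule Vector_Spaces.linear.axioms)
  note hom = lin[THEN Vector_Spaces.linear.axioms(3)]
  note b = hom(1)[THEN module_hom.add] hom(2)[THEN module_hom.add]
    hom(1)[THEN module_hom.scale] hom(2)[THEN module_hom.scale]
  define \<phi> where "\<phi> w = (case w of [a, b] \<Rightarrow> \<beta> a b | _ \<Rightarrow> 0)" for w
  let ?E = "free_extend scale' \<phi>"
  interpret E: Vector_Spaces.linear free_scale scale' ?E by (rule V'.free_extend_linear)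
  have rel: "multilinear_relations scale \<subseteq> {p. ?E p = 0}"
    by (auto simp: multilinear_relations_def E.diff \<phi>_def b Cons_eq_append_conv append_eq_Cons_conv
        split: list.splits)
  have sub: "free.subspace {p. ?E p = 0}"
    by (auto simp: free.subspace_def E.add E.scale)
  have ev: "?E (\<Sum>w\<leftarrow>map (\<lambda>(a, b). [a, b]) l. Poly_Mapping.single w 1) = (\<Sum>(a, b)\<leftarrow>l. \<beta> a b)" for l
  proof (induction l)
    case Nil
    show ?case by (simp add: E.zero)
  next
    case (Cons p l)
    have "\<phi> [a, b] = \<beta> a b" for a b by (simp add: \<phi>_def)
    with Cons show ?case by (cases p) (simp add: E.add del: map_map)
  qed
  from eq free.span_minimal[OF rel sub] show ?thesis
    unfolding tensor2_eq_def tensor_eq_def by (auto simp: E.diff ev simp del: map_map)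
qed

locale lie_to_algebra = lie_algebra scale bracket + A: unital_algebra scaleA
  for scale :: "'k::field \<Rightarrow> 'g::ab_group_add \<Rightarrow> 'g" and bracket
    and scaleA :: "'k \<Rightarrow> 'a::ring_1 \<Rightarrow> 'a" +
  fixes \<phi> :: "'g \<Rightarrow> 'a"
  assumes phi_linear: "Vector_Spaces.linear scale scaleA \<phi>"
    and phi_bracket: "\<phi> (bracket x y) = \<phi> x * \<phi> y - \<phi> y * \<phi> x"
begin

abbreviation "eval \<equiv> free_extend scaleA (\<lambda>w. prod_list (map \<phi> w))"

lemma eval_relations: "free.span (enveloping_relations scale bracket) \<subseteq> {p. eval p = 0}"
proof -
  interpret E: Vector_Spaces.linear free_scale scaleA eval by (rule A.free_extend_linear)
  interpret P: Vector_Spaces.linear scale scaleA \<phi> by (rule phi_linear)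
  have sub: "free.subspace {p. eval p = 0}"
    by (auto simp: free.subspace_def E.add E.scale E.zero)
  have "enveloping_relations scale bracket \<subseteq> {p. eval p = 0}"
    by (auto simp: enveloping_relations_def multilinear_relations_def E.diff P.add P.scale phi_bracket
        A.scale_mult_left[symmetric] A.scale_mult_right[symmetric] ring_distribs mult.assoc)
  from free.span_minimal[OF this sub] show ?thesis .
qed

end

lemma (in unital_algebra) eval_mult:
  fixes \<phi> :: "'g \<Rightarrow> 'u"
  defines "eval \<equiv> free_extend scale (\<lambda>w. prod_list (map \<phi> w))"
  shows "eval (\<Sum>u\<in>Poly_Mapping.keys p. \<Sum>v\<in>Poly_Mapping.keys q.
      Poly_Mapping.single (u @ v) (Poly_Mapping.lookup p u * Poly_Mapping.lookup q v)) = eval p * eval q"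
proof -
  interpret E: Vector_Spaces.linear free_scale scale eval
    unfolding eval_def by (rule free_extend_linear)
  have "eval p * eval q = (\<Sum>u\<in>Poly_Mapping.keys p. \<Sum>v\<in>Poly_Mapping.keys q.
      scale (Poly_Mapping.lookup p u) (prod_list (map \<phi> u))
      * scale (Poly_Mapping.lookup q v) (prod_list (map \<phi> v)))"
    unfolding eval_def free_extend_def sum_product ..
  then show ?thesis
    by (simp add: E.sum) (simp add: eval_def scale_mult_left[symmetric] scale_mult_right[symmetric] mult.commute)
qed

theorem (in enveloping_algebra) universal_property:
  fixes scaleA :: "'k \<Rightarrow> 'a::ring_1 \<Rightarrow> 'a" and \<phi> :: "'g \<Rightarrow> 'a"
  assumes "unital_algebra scaleA" "Vector_Spaces.linear scale scaleA \<phi>"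
    and "\<And>x y. \<phi> (bracket x y) = \<phi> x * \<phi> y - \<phi> y * \<phi> x"
  shows "\<exists>!\<psi>. Vector_Spaces.linear scaleU scaleA \<psi> \<and> \<psi> 1 = 1 \<and> (\<forall>x y. \<psi> (x * y) = \<psi> x * \<psi> y) \<and>
    (\<forall>x. \<psi> (\<iota> x) = \<phi> x)"
proof -
  interpret lie_to_algebra scale bracket scaleA \<phi>
    using assms lie_algebra_axioms by (intro lie_to_algebra.intro lie_to_algebra_axioms.intro)
  let ?U = "free_extend scaleU (\<lambda>w. prod_list (map \<iota> w))"
  interpret EU: Vector_Spaces.linear free_scale scaleU ?U by (rule U.free_extend_linear)
  interpret EA: Vector_Spaces.linear free_scale scaleA eval by (rule A.free_extend_linear)
  define \<psi> where "\<psi> u = eval (inv ?U u)" for u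
  have psi: "\<psi> (?U p) = eval p" for p
  proof -
    have "?U (inv ?U (?U p) - p) = 0"
      by (simp add: EU.diff surj_f_inv_f[OF enveloping_surj])
    then have "eval (inv ?U (?U p) - p) = 0"
      using enveloping_kernel eval_relations by blast
    then show ?thesis by (simp add: \<psi>_def EA.diff)
  qed
  have ex: "\<exists>p. u = ?U p" for u using enveloping_surj by (rule surjD)
  have lin: "\<psi> (x + y) = \<psi> x + \<psi> y" "\<psi> (scaleU c x) = scaleA c (\<psi> x)" "\<psi> (x * y) = \<psi> x * \<psi> y" for c x y
  proof -
    obtain p q where [simp]: "x = ?U p" "y = ?U q" using ex by meson
    show "\<psi> (x + y) = \<psi> x + \<psi> y"
      using psi[of "p + q"] by (simp add: psi EU.add EA.add)
    show "\<psi> (scaleU c x) = scaleA c (\<psi> x)"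
      using psi[of "free_scale c p"] by (simp add: psi EU.scale EA.scale)
    show "\<psi> (x * y) = \<psi> x * \<psi> y"
      unfolding \<open>x = ?U p\<close> \<open>y = ?U q\<close> U.eval_mult[symmetric] psi by (rule A.eval_mult)
  qed
  have 1: "\<psi> 1 = 1" using psi[of "Poly_Mapping.single [] 1"] by simp
  have g: "\<psi> (\<iota> x) = \<phi> x" for x using psi[of "Poly_Mapping.single [x] 1"] by simp
  show ?thesis
  proof (rule ex1I[of _ \<psi>], intro conjI allI)
    show "Vector_Spaces.linear scaleU scaleA \<psi>"
      by (intro Vector_Spaces.linear.intro module_hom.intro module_hom_axioms.intro lin)
        unfold_locales
    show "\<psi> (x * y) = \<psi> x * \<psi> y" for x y by (rule lin)
    show "\<psi> 1 = 1" "\<psi> (\<iota> x) = \<phi> x" for x by (fact 1 g)+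
    fix \<psi>'
    assume *: "Vector_Spaces.linear scaleU scaleA \<psi>' \<and> \<psi>' 1 = 1 \<and> (\<forall>x y. \<psi>' (x * y) = \<psi>' x * \<psi>' y) \<and>
      (\<forall>x. \<psi>' (\<iota> x) = \<phi> x)"
    then interpret P: Vector_Spaces.linear scaleU scaleA \<psi>' by blast
    have w: "\<psi>' (prod_list (map \<iota> w)) = prod_list (map \<phi> w)" for w
      by (induction w) (use * in auto)
    have "\<psi>' (?U p) = eval p" for p
      unfolding free_extend_def by (simp add: P.sum P.scale w)
    then show "\<psi>' = \<psi>" using ex psi by (metis ext)
  qed
qed

end

theory Submission
  imports Defs
begin

text \<open>
  Write \<open>f \<triangleright> g\<close> for the right-hand side \<open>B(f\<^sub>1) g S(B(f\<^sub>2))\<close> and let \<open>y = \<iota> (R x)\<close>.  The Rota-Baxter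
  identity for a primitive first argument reads \<open>B(xf) = y B(f) - B([y, f])\<close>, and since \<open>S(ya) = -S(a)y\<close>
  it gives \<open>(xf) \<triangleright> g = [y, f \<triangleright> g] - [y, f] \<triangleright> g\<close>.  The extended post-Lie product obeys the same
  recursion, because \<open>x\<close> acts by it as a derivation that agrees with \<open>[y, _]\<close> on \<open>\<gg>\<close>.  As \<open>[y, _]\<close>
  preserves the span of products of \<open>n\<close> elements of \<open>\<gg>\<close>, the two agree by induction on \<open>n\<close>.
\<close>

section \<open>Multilinear maps on Sweedler representatives\<close>

lemma bilinear_mapI:
  assumes "vector_space s1" "vector_space s2" "vector_space s3"
    and "\<And>x y z. \<beta> (x + y) z = \<beta> x z + \<beta> y z" "\<And>x y z. \<beta> x (y + z) = \<beta> x y + \<beta> x z"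
    and "\<And>c x y. \<beta> (s1 c x) y = s3 c (\<beta> x y)" "\<And>c x y. \<beta> x (s2 c y) = s3 c (\<beta> x y)"
  shows "bilinear_map s1 s2 s3 \<beta>"
  unfolding bilinear_map_def Vector_Spaces.linear_iff using assms by auto

lemma bilinear_mapD:
  assumes "bilinear_map s1 s2 s3 \<beta>"
  shows "\<beta> (x + y) z = \<beta> x z + \<beta> y z" "\<beta> x (y' + z) = \<beta> x y' + \<beta> x z"
    "\<beta> (s1 c x) y' = s3 c (\<beta> x y')" "\<beta> x (s2 c y') = s3 c (\<beta> x y')"
  using assms unfolding bilinear_map_def Vector_Spaces.linear_iff by auto

text \<open>The trilinear counterpart of \<open>sweedler_sum_cong\<close>: the linear extension of
  \<open>\<beta>\<close> to lists kills the tensor relations. It makes coassociativity usable inside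
  sums.\<close>

lemma sweedler_sum3_cong:
  assumes "vector_space s" "vector_space s'"
    and add: "\<And>x y b c. \<beta> (x + y) b c = \<beta> x b c + \<beta> y b c" "\<And>a x y c. \<beta> a (x + y) c = \<beta> a x c + \<beta> a y c"
      "\<And>a b x y. \<beta> a b (x + y) = \<beta> a b x + \<beta> a b y"
    and scl: "\<And>k a b c. \<beta> (s k a) b c = s' k (\<beta> a b c)" "\<And>k a b c. \<beta> a (s k b) c = s' k (\<beta> a b c)"
      "\<And>k a b c. \<beta> a b (s k c) = s' k (\<beta> a b c)"
    and eq: "tensor3_eq s t t'"
  shows "(\<Sum>(a, b, c)\<leftarrow>t. \<beta> a b c) = (\<Sum>(a, b, c)\<leftarrow>t'. \<beta> a b c)"
proof -
  interpret V: vector_space s by fact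
  interpret V': vector_space s' by fact
  \<comment> \<open>The default 0 disposes of the relations between lists of any other
    length.\<close>
  define \<phi> where "\<phi> w = (case w of [a, b, c] \<Rightarrow> \<beta> a b c | _ \<Rightarrow> 0)" for w
  let ?E = "free_extend s' \<phi>"
  interpret E: Vector_Spaces.linear free_scale s' ?E by (rule V'.free_extend_linear)
  have rel: "multilinear_relations s \<subseteq> {p. ?E p = 0}"
    by (auto simp: multilinear_relations_def E.diff \<phi>_def add scl Cons_eq_append_conv append_eq_Cons_conv
        split: list.splits)
  have sub: "free.subspace {p. ?E p = 0}"
    by (auto simp: free.subspace_def E.add E.scale)
  have ev: "?E (\<Sum>w\<leftarrow>map (\<lambda>(a, b, c). [a, b, c]) l. Poly_Mapping.single w 1) = (\<Sum>(a, b, c)\<leftarrow>l. \<beta> a b c)" for l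
  proof (induction l)
    case Nil
    show ?case by (simp add: E.zero)
  next
    case (Cons p l)
    have "\<phi> [a, b, c] = \<beta> a b c" for a b c by (simp add: \<phi>_def)
    with Cons show ?case by (cases p) (simp add: E.add del: map_map)
  qed
  from eq free.span_minimal[OF rel sub] show ?thesis
    unfolding tensor3_eq_def tensor_eq_def by (auto simp: E.diff ev simp del: map_map)
qed

lemma sum_list_concat: "sum_list (concat xss) = sum_list (map sum_list xss)"
  for xss :: "'a::monoid_add list list"
  by (induction xss) auto

section \<open>Sweedler sums and the antipode at primitive elements\<close>

context cocommutative_hopf_algebra
begin

lemma is_vector_space: "vector_space scale" by unfold_locales

lemma sweedler_add:
  assumes "bilinear_map scale scale scale \<beta>"
  shows "(\<Sum>(a, b)\<leftarrow>\<Delta> (x + y). \<beta> a b) = (\<Sum>(a, b)\<leftarrow>\<Delta> x. \<beta> a b) + (\<Sum>(a, b)\<leftarrow>\<Delta> y. \<beta> a b)"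
  using sweedler_sum_cong[OF assms comult_add] by simp

lemma scale_sum_list: "scale c (sum_list xs) = (\<Sum>x\<leftarrow>xs. scale c x)"
  by (induction xs) (auto simp: scale_right_distrib)

lemma sweedler_scale:
  assumes "bilinear_map scale scale scale \<beta>"
  shows "(\<Sum>(a, b)\<leftarrow>\<Delta> (scale c x). \<beta> a b) = scale c (\<Sum>(a, b)\<leftarrow>\<Delta> x. \<beta> a b)"
  using sweedler_sum_cong[OF assms comult_scale]
  by (simp add: scale_sum_list o_def case_prod_unfold bilinear_mapD[OF assms] concat_map_singleton)

lemma sweedler_one:
  assumes "bilinear_map scale scale scale \<beta>"
  shows "(\<Sum>(a, b)\<leftarrow>\<Delta> 1. \<beta> a b) = \<beta> 1 1"
  using sweedler_sum_cong[OF assms comult_one] by simp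

lemma S_add: "S (x + y) = S x + S y" and S_scale: "S (scale c x) = scale c (S x)"
  using antipode_linear by (auto simp: Vector_Spaces.linear_iff)

lemma S_one: "S 1 = 1"
  using sweedler_one[of "\<lambda>a b. a * S b"] antipode_right[of 1] counit_one
  by (simp add: bilinear_mapI is_vector_space S_add S_scale ring_distribs scale_mult_left[symmetric] scale_mult_right[symmetric])

text \<open>A predicate on the whole Hopf algebra, so that the results serve both
  \<open>\<iota> x\<close> and its image under \<open>B\<close>.\<close>

definition is_primitive :: "'u \<Rightarrow> bool" where
  "is_primitive y \<longleftrightarrow> tensor2_eq scale (\<Delta> y) [(y, 1), (1, y)]"

lemma sweedler_primitive:
  assumes "bilinear_map scale scale scale \<beta>" "is_primitive y"
  shows "(\<Sum>(a, b)\<leftarrow>\<Delta> y. \<beta> a b) = \<beta> y 1 + \<beta> 1 y"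
  using sweedler_sum_cong[OF assms(1) assms(2)[unfolded is_primitive_def]] by simp

lemma counit_bilinear: "bilinear_map scale scale scale (\<lambda>a b. scale (\<epsilon> a) b)"
  using counit_linear by (intro bilinear_mapI is_vector_space) (auto simp: Vector_Spaces.linear_iff algebra_simps)

text \<open>The left counit law on \<open>y \<otimes> 1 + 1 \<otimes> y\<close> leaves
  \<open>scale (\<epsilon> y) 1 = 0\<close>, to which \<open>\<epsilon>\<close> is applied.\<close>

lemma counit_primitive:
  assumes "is_primitive y" shows "\<epsilon> y = 0"
proof -
  interpret E: Vector_Spaces.linear scale "(*)" \<epsilon> by (rule counit_linear)
  have "scale (\<epsilon> y) 1 = 0"
    using sweedler_primitive[OF counit_bilinear assms] counit_left[of y] counit_one by simp
  then have "\<epsilon> (scale (\<epsilon> y) 1) = 0" by (simp add: E.zero)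
  then show ?thesis by (simp add: E.scale counit_one)
qed

lemma sweedler_mult:
  assumes "bilinear_map scale scale scale \<beta>"
  shows "(\<Sum>(a, b)\<leftarrow>\<Delta> (x * y). \<beta> a b) = (\<Sum>(a, b)\<leftarrow>\<Delta> x. \<Sum>(c, d)\<leftarrow>\<Delta> y. \<beta> (a * c) (b * d))"
  using sweedler_sum_cong[OF assms comult_mult, of x y]
  by (simp add: case_prod_unfold map_concat sum_list_concat o_def)

lemmas mult_scale = scale_mult_left[symmetric] scale_mult_right[symmetric]

text \<open>\<open>\<Delta>\<close> is multiplicative and \<open>\<Delta> y\<close> is
  \<open>y \<otimes> 1 + 1 \<otimes> y\<close>. The two sides together give the coproduct of the
  commutator \<open>y * f - f * y\<close>.\<close>

lemma sweedler_primitive_mult: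
  assumes \<beta>: "bilinear_map scale scale scale \<beta>" and y: "is_primitive y"
  shows "(\<Sum>(a, b)\<leftarrow>\<Delta> (y * f). \<beta> a b) = (\<Sum>(a, b)\<leftarrow>\<Delta> f. \<beta> (y * a) b) + (\<Sum>(a, b)\<leftarrow>\<Delta> f. \<beta> a (y * b))"
    and "(\<Sum>(a, b)\<leftarrow>\<Delta> (f * y). \<beta> a b) = (\<Sum>(a, b)\<leftarrow>\<Delta> f. \<beta> (a * y) b) + (\<Sum>(a, b)\<leftarrow>\<Delta> f. \<beta> a (b * y))"
proof -
  note b = bilinear_mapD[OF \<beta>]
  have "bilinear_map scale scale scale (\<lambda>a b. \<Sum>(c, d)\<leftarrow>\<Delta> f. \<beta> (a * c) (b * d))"
    by (intro bilinear_mapI is_vector_space)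
      (simp_all add: case_prod_unfold b ring_distribs mult_scale sum_list_addf scale_sum_list o_def)
  from sweedler_primitive[OF this y]
  show "(\<Sum>(a, b)\<leftarrow>\<Delta> (y * f). \<beta> a b) = (\<Sum>(a, b)\<leftarrow>\<Delta> f. \<beta> (y * a) b) + (\<Sum>(a, b)\<leftarrow>\<Delta> f. \<beta> a (y * b))"
    by (simp add: sweedler_mult[OF \<beta>])
  have "(\<Sum>(c, d)\<leftarrow>\<Delta> y. \<beta> (a * c) (b * d)) = \<beta> (a * y) b + \<beta> a (b * y)" for a b
    using sweedler_primitive[of "\<lambda>c d. \<beta> (a * c) (b * d)", OF _ y]
    by (simp add: bilinear_mapI is_vector_space b ring_distribs mult_scale)
  then show "(\<Sum>(a, b)\<leftarrow>\<Delta> (f * y). \<beta> a b) = (\<Sum>(a, b)\<leftarrow>\<Delta> f. \<beta> (a * y) b) + (\<Sum>(a, b)\<leftarrow>\<Delta> f. \<beta> a (b * y))"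
    unfolding sweedler_mult[OF \<beta>] by (simp add: case_prod_unfold sum_list_addf)
qed

text \<open>In the convolution algebra \<open>id\<close> has the inverse \<open>S\<close>, so \<open>T = (T * id) * S\<close>.\<close>

lemma convolution_id_eq_0D:
  assumes T: "Vector_Spaces.linear scale scale T" and 0: "\<And>a. (\<Sum>(b, c)\<leftarrow>\<Delta> a. T b * c) = 0"
  shows "T a = 0"
proof -
  note T' = T[unfolded Vector_Spaces.linear_iff]
  let ?\<beta> = "\<lambda>a b c. T a * b * S c"
  have "T a = T (\<Sum>(b, c)\<leftarrow>\<Delta> a. scale (\<epsilon> c) b)" by (simp add: counit_right)
  also have "\<dots> = (\<Sum>(b, c)\<leftarrow>\<Delta> a. T b * scale (\<epsilon> c) 1)"
  proof -
    interpret T: Vector_Spaces.linear scale scale T by (rule T)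
    have "T (sum_list xs) = sum_list (map T xs)" for xs by (induction xs) (auto simp: T.add T.zero)
    then show ?thesis by (simp add: o_def case_prod_unfold T.scale mult_scale)
  qed
  also have "\<dots> = (\<Sum>(b, c)\<leftarrow>\<Delta> a. \<Sum>(c1, c2)\<leftarrow>\<Delta> c. ?\<beta> b c1 c2)"
    by (simp only: antipode_right[symmetric]) (simp add: sum_list_const_mult[symmetric] case_prod_unfold mult.assoc)
  also have "\<dots> = (\<Sum>(a, b, c)\<leftarrow>[(a, b1, b2). (a, b) \<leftarrow> \<Delta> a, (b1, b2) \<leftarrow> \<Delta> b]. ?\<beta> a b c)"
    by (simp add: case_prod_unfold map_concat sum_list_concat o_def)
  also have "\<dots> = (\<Sum>(a, b, c)\<leftarrow>[(a1, a2, b). (a, b) \<leftarrow> \<Delta> a, (a1, a2) \<leftarrow> \<Delta> a]. ?\<beta> a b c)"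
    by (rule sweedler_sum3_cong[OF is_vector_space is_vector_space _ _ _ _ _ _ coassoc, symmetric])
      (use T' in \<open>simp_all add: S_add S_scale ring_distribs mult_scale\<close>)
  also have "\<dots> = (\<Sum>(a, b)\<leftarrow>\<Delta> a. (\<Sum>(a1, a2)\<leftarrow>\<Delta> a. T a1 * a2) * S b)"
    by (simp add: case_prod_unfold map_concat sum_list_concat o_def sum_list_mult_const[symmetric])
  also have "\<dots> = 0" by (simp add: 0[unfolded case_prod_unfold] case_prod_unfold)
  finally show ?thesis .
qed

text \<open>The defect \<open>?T\<close> has convolution product 0 with the identity: since
  \<open>\<epsilon> (y * a) = 0\<close>, this is the left antipode law at \<open>y * a\<close>, with
  \<open>\<Delta> (y * a)\<close> split into its two sums.\<close>

lemma antipode_primitive_mult: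
  assumes y: "is_primitive y"
  shows "S (y * a) = - (S a * y)"
proof -
  let ?T = "\<lambda>a. S (y * a) + S a * y"
  have "?T a = 0"
  proof (rule convolution_id_eq_0D[of ?T])
    show "Vector_Spaces.linear scale scale ?T"
      unfolding Vector_Spaces.linear_iff by (simp add: is_vector_space S_add S_scale ring_distribs mult_scale scale_right_distrib)
    show "(\<Sum>(b, c)\<leftarrow>\<Delta> a. ?T b * c) = 0" for a
    proof -
      have "bilinear_map scale scale scale (\<lambda>a b. S a * b)"
        by (intro bilinear_mapI is_vector_space) (simp_all add: S_add S_scale ring_distribs mult_scale)
      from sweedler_primitive_mult(1)[OF this y, of a] antipode_left[of "y * a"]
      show ?thesis
        by (simp add: counit_mult counit_primitive[OF y] case_prod_unfold sum_list_addf ring_distribs mult.assoc)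
    qed
  qed
  then show ?thesis by (simp add: eq_neg_iff_add_eq_0)
qed

lemma antipode_primitive: "is_primitive y \<Longrightarrow> S y = - y"
  using antipode_primitive_mult[of y 1] by (simp add: S_one)

end

section \<open>Rota-Baxter operators and the conjugation they induce\<close>

context rota_baxter_hopf_algebra
begin

lemma B_add: "B (x + y) = B x + B y" and B_scale: "B (scale c x) = scale c (B x)"
  and B_diff: "B (x - y) = B x - B y"
  using B_linear module_hom.diff[OF Vector_Spaces.linear.axioms(3)[OF B_linear]]
  by (auto simp: Vector_Spaces.linear_iff)

lemmas multilinear_simps = S_add S_scale B_add B_scale ring_distribs mult_scale

text \<open>The operation f \<triangleright> g of the overview. As \<open>B\<close> is a coalgebra
  map, it is the adjoint action of \<open>B f\<close> on \<open>g\<close>.\<close>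

definition conjugate :: "'u \<Rightarrow> 'u \<Rightarrow> 'u" where
  "conjugate f g = (\<Sum>(a, b)\<leftarrow>\<Delta> f. B a * g * S (B b))"

lemma conjugate_bilinear: "bilinear_map scale scale scale (\<lambda>a b. B a * g * S (B b))"
  by (intro bilinear_mapI is_vector_space) (simp_all add: multilinear_simps)

text \<open>With nested sums over pairs, the bilinear rules apply first to the outer and then to the
  inner comultiplication.\<close>

lemma B_rota_baxter_nested: "B x * B y = B (\<Sum>(a, b)\<leftarrow>\<Delta> x. \<Sum>(a1, a2)\<leftarrow>\<Delta> a. a1 * B a2 * y * S (B b))"
  unfolding B_rota_baxter by (simp add: case_prod_unfold map_concat sum_list_concat o_def)

lemma rota_baxter_inner_bilinear: "bilinear_map scale scale scale (\<lambda>a b. a * B b * y * S z)"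
  by (intro bilinear_mapI is_vector_space) (simp_all add: multilinear_simps)

lemma rota_baxter_bilinear:
  "bilinear_map scale scale scale (\<lambda>a b. \<Sum>(a1, a2)\<leftarrow>\<Delta> a. a1 * B a2 * y * S (B b))"
  by (intro bilinear_mapI is_vector_space)
    (simp_all add: sweedler_add sweedler_scale rota_baxter_inner_bilinear,
     simp_all add: multilinear_simps case_prod_unfold sum_list_addf scale_sum_list o_def)

lemma B_one: "B 1 = 1"
proof -
  have bil: "bilinear_map scale scale scale (\<lambda>a b. a * S b)"
    "bilinear_map scale scale scale (\<lambda>a b. B a * S (B b))"
    by (intro bilinear_mapI is_vector_space; simp add: multilinear_simps)+
  \<comment> \<open>\<open>B 1\<close> is grouplike, hence invertible; the Rota-Baxter identity makes it idempotent.\<close>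
  have inv: "B 1 * S (B 1) = 1"
    using sweedler_sum_cong[OF bil(1) B_comult[of 1]] antipode_right[of "B 1"] sweedler_one[OF bil(2)]
    by (simp add: B_counit counit_one case_prod_unfold o_def concat_map_singleton)
  have "B 1 * B 1 = B 1"
    unfolding B_rota_baxter_nested sweedler_one[OF rota_baxter_bilinear] sweedler_one[OF rota_baxter_inner_bilinear]
    by (simp add: inv)
  then have "B 1 * (B 1 * S (B 1)) = B 1 * S (B 1)" by (simp add: mult.assoc[symmetric])
  then show ?thesis by (simp add: inv)
qed

text \<open>The iterated coproduct of \<open>x\<close> has \<open>x\<close> in one of three slots
  and 1 in the others. As \<open>B 1 = 1\<close> and \<open>S (B x) = - B x\<close>, the slots
  contribute \<open>x * h\<close>, \<open>B x * h\<close> and \<open>- h * B x\<close>.\<close>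

lemma B_primitive_mult:
  assumes x: "is_primitive x" and Bx: "is_primitive (B x)"
  shows "B (x * h) = B x * B h - B (B x * h - h * B x)"
proof -
  have "B x * B h = B (x * h + B x * h - h * B x)"
    unfolding B_rota_baxter_nested[of x] sweedler_primitive[OF rota_baxter_bilinear x]
      sweedler_one[OF rota_baxter_inner_bilinear] sweedler_primitive[OF rota_baxter_inner_bilinear x]
    by (simp add: B_one S_one antipode_primitive[OF Bx])
  then show ?thesis by (simp add: B_add B_diff)
qed

lemma conjugate_add: "conjugate (x + y) g = conjugate x g + conjugate y g"
  and conjugate_scale: "conjugate (scale c x) g = scale c (conjugate x g)"
  unfolding conjugate_def by (simp_all add: sweedler_add sweedler_scale conjugate_bilinear)

lemma conjugate_diff: "conjugate (x - y) g = conjugate x g - conjugate y g"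
  using conjugate_add[of "x - y" y g] by simp

lemma conjugate_one: "conjugate 1 g = g"
  unfolding conjugate_def by (simp add: sweedler_one[OF conjugate_bilinear] B_one S_one)

text \<open>\<open>\<Delta> (x * f)\<close> gives two sums, and \<open>B_primitive_mult\<close>
  expands the factor containing \<open>x\<close> in each. The leading terms form the commutator with
  \<open>B x\<close>; the corrections recombine, as \<open>B x\<close> is primitive, into the
  coproduct of \<open>B x * f - f * B x\<close>.\<close>

lemma conjugate_primitive_mult:
  assumes x: "is_primitive x" and Bx: "is_primitive (B x)"
  shows "conjugate (x * f) g
    = B x * conjugate f g - conjugate f g * B x - conjugate (B x * f - f * B x) g"
proof -
  interpret S: Vector_Spaces.linear scale scale S by (rule antipode_linear)
  have sums: "sum_list (map u xs) * z = (\<Sum>x\<leftarrow>xs. u x * z)" "z * sum_list (map u xs) = (\<Sum>x\<leftarrow>xs. z * u x)"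
    "(\<Sum>x\<leftarrow>xs. - u x) = - sum_list (map u xs)"
    for u :: "'u \<times> 'u \<Rightarrow> 'u" and xs z
    by (simp_all add: sum_list_mult_const sum_list_const_mult) (induction xs; simp)
  show ?thesis
    \<comment> \<open>The commutator is split first, so that the left and right product rules can
      each match one half.\<close>
    unfolding conjugate_diff
    unfolding conjugate_def sweedler_primitive_mult[OF conjugate_bilinear x]
      sweedler_primitive_mult[OF conjugate_bilinear Bx]
    by (simp add: case_prod_unfold B_primitive_mult[OF x Bx] B_diff S.diff antipode_primitive_mult[OF Bx]
        sums ring_distribs mult.assoc sum_list_addf sum_list_subtractf)
qed

end

section \<open>Words in the enveloping algebra\<close>

context enveloping_algebra
begin

lemma relation_eval_eq_0: "p \<in> enveloping_relations scale bracket \<Longrightarrow> free_extend scaleU (\<lambda>w. prod_list (map \<iota> w)) p = 0"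
  using enveloping_kernel free.span_base by blast

lemma iota_bracket: "\<iota> (bracket x y) = \<iota> x * \<iota> y - \<iota> y * \<iota> x"
proof -
  let ?E = "free_extend scaleU (\<lambda>w. prod_list (map \<iota> w))"
  interpret E: Vector_Spaces.linear free_scale scaleU ?E by (rule U.free_extend_linear)
  have "Poly_Mapping.single ([] @ [x, y] @ []) 1 - Poly_Mapping.single ([] @ [y, x] @ []) 1
       - Poly_Mapping.single ([] @ [bracket x y] @ []) 1 \<in> enveloping_relations scale bracket"
    unfolding enveloping_relations_def by blast
  from relation_eval_eq_0[OF this] show ?thesis by (simp add: E.diff)
qed

text \<open>Exactly \<open>n\<close> factors. This is no grading:
  \<open>\<iota> x * \<iota> y - \<iota> y * \<iota> x\<close> lies in \<open>words 2\<close> and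
  also in \<open>words 1\<close>.\<close>

definition words :: "nat \<Rightarrow> 'u set" where
  "words n = U.span {prod_list (map \<iota> w) | w. length w = n}"

lemma prod_list_in_words: "length w = n \<Longrightarrow> prod_list (map \<iota> w) \<in> words n"
  unfolding words_def by (intro U.span_base) blast

text \<open>Evaluation of the free algebra is onto, so the products span. Linear statements about
  \<open>'u\<close> are reduced to products this way.\<close>

lemma subspace_containing_products:
  assumes "U.subspace A" "\<And>w. prod_list (map \<iota> w) \<in> A"
  shows "u \<in> A"
proof -
  obtain p where "u = free_extend scaleU (\<lambda>w. prod_list (map \<iota> w)) p"
    using enveloping_surj by (rule surjE)
  then show ?thesis
    unfolding free_extend_def using assms by (auto intro!: U.subspace_sum U.subspace_scale)
qed

lemma iota_mult_words:
  assumes "u \<in> words n" shows "\<iota> x * u \<in> words (Suc n)"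
proof -
  have "words n \<subseteq> {u. \<iota> x * u \<in> words (Suc n)}"
    unfolding words_def[of n]
  proof (rule U.span_minimal)
    show "U.subspace {u. \<iota> x * u \<in> words (Suc n)}"
      unfolding words_def U.subspace_def
      by (auto simp: ring_distribs U.scale_mult_right[symmetric] intro: U.span_zero U.span_add U.span_scale)
    show "{prod_list (map \<iota> w) |w. length w = n} \<subseteq> {u. \<iota> x * u \<in> words (Suc n)}"
      using prod_list_in_words[of "x # w" for w] by auto
  qed
  with assms show ?thesis by blast
qed

text \<open>By the Leibniz rule [y, zw] = [y, z]w + z[y, w]. The first summand trades the factor
  \<open>z\<close> for \<open>bracket y z\<close>, which keeps the length.\<close>

lemma commutator_words:
  "length w = n \<Longrightarrow> \<iota> y * prod_list (map \<iota> w) - prod_list (map \<iota> w) * \<iota> y \<in> words n"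
proof (induction w arbitrary: n)
  case Nil
  then show ?case by (simp add: words_def U.span_zero)
next
  case (Cons z w)
  let ?w = "prod_list (map \<iota> w)"
  have "\<iota> (bracket y z) * ?w \<in> words n" "\<iota> z * (\<iota> y * ?w - ?w * \<iota> y) \<in> words n"
    using Cons iota_mult_words[OF prod_list_in_words] iota_mult_words by auto
  then have "\<iota> (bracket y z) * ?w + \<iota> z * (\<iota> y * ?w - ?w * \<iota> y) \<in> words n"
    unfolding words_def by (rule U.span_add)
  then show ?case by (simp add: iota_bracket algebra_simps)
qed

end

section \<open>The extended post-Lie product with an element of the Lie algebra\<close>

lemma (in enveloping_hopf_algebra) is_primitive_iota: "is_primitive (\<iota> x)"
  using primitive by (simp add: is_primitive_def)

context post_lie_extension
begin

lemmas ext_bilinear_simps = bilinear_mapD[OF ext_bilinear]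

lemma ext_zero_left: "ext 0 g = 0" and ext_zero_right: "ext g 0 = 0"
  using ext_bilinear_simps(1)[of 0 0 g] ext_bilinear_simps(2)[of g 0 0] by simp_all

text \<open>The coproduct rule for a primitive left argument is the Leibniz rule, because
  \<open>ext 1\<close> is the identity.\<close>

lemma ext_iota_mult: "ext (\<iota> x) (g * h) = ext (\<iota> x) g * h + g * ext (\<iota> x) h"
proof -
  have "bilinear_map scaleU scaleU scaleU (\<lambda>a b. ext a g * ext b h)"
    by (intro bilinear_mapI is_vector_space) (simp_all add: ext_bilinear_simps ring_distribs mult_scale)
  from sweedler_primitive[OF this is_primitive_iota] show ?thesis
    by (simp add: ext_mult_right ext_one)
qed

lemma ext_iota_one: "ext (\<iota> x) 1 = 0"
  using ext_iota_mult[of x 1 1] by simp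

text \<open>Both sides are derivations in \<open>h\<close> and agree on the image of
  \<open>\<iota>\<close>, hence on products. Later \<open>z\<close> is \<open>R x\<close>.\<close>

lemma ext_iota_inner:
  assumes "\<And>y. post x y = bracket z y"
  shows "ext (\<iota> x) h = \<iota> z * h - h * \<iota> z"
proof -
  have "h \<in> {h. ext (\<iota> x) h = \<iota> z * h - h * \<iota> z}"
  proof (rule subspace_containing_products)
    show "U.subspace {h. ext (\<iota> x) h = \<iota> z * h - h * \<iota> z}"
      by (auto simp: U.subspace_def ext_bilinear_simps ext_zero_right ring_distribs mult_scale U.scale_right_diff_distrib)
    fix w show "prod_list (map \<iota> w) \<in> {h. ext (\<iota> x) h = \<iota> z * h - h * \<iota> z}"
      by (induction w)
        (simp_all add: ext_iota_one ext_iota_mult ext_extends assms iota_bracket, simp add: algebra_simps)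
  qed
  then show ?thesis by simp
qed

end

section \<open>Comparison of the two operations by word length\<close>

theorem proposition3:
  fixes scale :: "'k::field_char_0 \<Rightarrow> 'g::ab_group_add \<Rightarrow> 'g"
    and bracket :: "'g \<Rightarrow> 'g \<Rightarrow> 'g"
    and R :: "'g \<Rightarrow> 'g"
    and scaleU :: "'k \<Rightarrow> 'u::ring_1 \<Rightarrow> 'u"
    and \<iota> :: "'g \<Rightarrow> 'u"
    and \<Delta> :: "'u \<Rightarrow> ('u \<times> 'u) list"
    and \<epsilon> :: "'u \<Rightarrow> 'k"
    and S B :: "'u \<Rightarrow> 'u"
    and ext :: "'u \<Rightarrow> 'u \<Rightarrow> 'u"
    and f g :: 'u
  assumes "rota_baxter_lie_algebra scale bracket R"
    and "enveloping_hopf_algebra scale bracket scaleU \<iota> \<Delta> \<epsilon> S"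
    and "rota_baxter_hopf_algebra scaleU \<Delta> \<epsilon> S B"
    and "\<And>x. B (\<iota> x) = \<iota> (R x)"
    and "post_lie_extension scale bracket scaleU \<iota> \<Delta> \<epsilon> S (\<lambda>x y. bracket (R x) y) ext"
  shows "ext f g = (\<Sum>(a, b)\<leftarrow>\<Delta> f. B a * g * S (B b))"
proof -
  interpret P: post_lie_extension scale bracket scaleU \<iota> \<Delta> \<epsilon> S "\<lambda>x y. bracket (R x) y" ext by fact
  interpret B: rota_baxter_hopf_algebra scaleU \<Delta> \<epsilon> S B by fact
  let ?A = "{f. \<forall>g. ext f g = B.conjugate f g}"
  have sub: "P.U.subspace ?A"
    \<comment> \<open>The scalar 0 supplies \<open>B.conjugate 0 g = 0\<close>, so that 0 lies in
      \<open>?A\<close>.\<close>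
    using B.conjugate_scale[of 0 0]
    by (auto simp: P.U.subspace_def P.ext_bilinear_simps P.ext_zero_left B.conjugate_add B.conjugate_scale)
  have prim: "P.is_primitive (\<iota> x)" "P.is_primitive (B (\<iota> x))" for x
    by (simp_all add: assms(4) P.is_primitive_iota)
  have "prod_list (map \<iota> w) \<in> ?A" for w
  \<comment> \<open>Structural induction would cover only the tail \<open>v\<close>; its commutator
    with \<open>?y\<close> involves other words of the same length.\<close>
  proof (induction "length w" arbitrary: w)
    case 0
    then show ?case by (simp add: P.ext_one B.conjugate_one)
  next
    case (Suc n)
    then obtain x v where w: "w = x # v" and n: "n = length v" by (cases w) auto
    let ?v = "prod_list (map \<iota> v)" and ?y = "\<iota> (R x)"
    \<comment> \<open>Linearity carries the induction hypothesis from words of length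
      \<open>n\<close> to their span, which contains the commutator.\<close>
    have "P.words n \<subseteq> ?A"
      unfolding P.words_def by (rule P.U.span_minimal[OF _ sub]) (use Suc(1) in auto)
    then have "?v \<in> ?A" "?y * ?v - ?v * ?y \<in> ?A"
      using P.prod_list_in_words P.commutator_words n by blast+
    \<comment> \<open>As \<open>ext (\<iota> x)\<close> is the commutator with \<open>?y\<close>,
      the two recursions have the same form.\<close>
    then show ?case
      by (simp add: w P.ext_mult_left P.ext_iota_inner[of x "R x"] B.conjugate_primitive_mult[OF prim] assms(4))
  qed
  then have "f \<in> ?A" by (rule P.subspace_containing_products[OF sub])
  then show ?thesis by (simp add: B.conjugate_def)
qed

end
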